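(* Let $\mathcal{M}=(\mathcal{S},\mathcal{E},\mathcal{A},\mathcal{Z},T_s,T_e,O)$ be a mixed observable Markov decision process (MOMDP), let $\mathcal{T}\subset\mathcal{S}$ be the target set associated with the specification $\psi$, and let $N$ be the finite horizon. Let $\Gamma^*_{s,k}$, $s\in\mathcal{S}$, $k\in\{0,\dots,N\}$, be the sets of support vector pairs constructed using the exact dynamic programming recursion defined in the context. Then the constraint value function $$J^*_k(s,b)=\max_{\langle\alpha,\beta\rangle\in\Gamma^*_{s,k}}\beta^\top b$$ represents the probability that the time-optimal quantitative policy $\pi^{\mathrm{TOQ}}:\mathcal{S}\times\mathcal{B}_{\mathcal{E}}\to\mathcal{A}$ satisfies the specification, i.e. $$J^*_k(s,b)=\mathbb{P}^{\pi^{\mathrm{TOQ}}}\big[[\omega_k,\dots,\omega_N]\models\psi\big]\qquad\forall k\in\{0,\dots,N\},\ \forall s\in\mathcal{S},\ \forall b\in\mathcal{B}_{\mathcal{E}},$$ where $s$ and $b$ are the observable state and the belief at time $k$.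
   Context: MOMDP. $\mathcal{S},\mathcal{E},\mathcal{A},\mathcal{Z}$ are finite sets: fully observable states, partially observable states, actions, and observations. $T_s(s,e,a,s')=\mathbb{P}(s_{t+1}=s'\mid s_t=s,e_t=e,a_t=a)$; $T_e(s,e,a,s',e')=\mathbb{P}(e_{t+1}=e'\mid s_t=s,e_t=e,a_t=a,s_{t+1}=s')$; $O(s',e',a,z)=\mathbb{P}(z_t=z\mid s_t=s',e_t=e',a_{t-1}=a)$. Put $$F(s,e,a,s',e',z)=T_s(s,e,a,s')\,T_e(s,e,a,s',e')\,O(s',e',a,z).$$ Beliefs. $\mathcal{B}_{\mathcal{E}}=\{b\in\mathbb{R}^{|\mathcal{E}|}: b(e)\ge 0,\ \sum_{e}b(e)=1\}$; the entry $b(e)$ is the posterior probability that the partially observable state equals $e$. After action $a$ in $(s,b)$ and reception of $(s',z)$, the belief is updated to $b'$ with $b'(e')=\eta\sum_{e}F(s,e,a,s',e',z)\,b(e)$, where $\eta=1/P(z,s'\mid s,b,a)$ is the normalization constant. Policies. A policy is a map $\kappa:\mathcal{S}\times\mathcal{B}_{\mathcal{E}}\to\mathcal{A}$, which selects the action $a_t=\kappa(s_t,b_t)$ from the current observable state and belief. $\mathbb{P}^\kappa,\mathbb{E}^\kappa$ denote probability and expectation for the closed-loop process under $\kappa$. The MOMDP state is $\omega_t=(s_t,e_t)$, and $\boldsymbol{\omega}$ is the closed-loop trajectory over the task duration $t=0,\dots,N$. Specification. $\psi$ is a reachability specification, satisfied when the observable state reaches $\mathcal{T}$: $[\omega_k,\dots,\omega_N]\models\psi$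 iff $s_t\in\mathcal{T}$ for some $t\in\{k,\dots,N\}$. Time-optimal quantitative policy. $\pi^{\mathrm{TOQ}}:\mathcal{S}\times\mathcal{B}_{\mathcal{E}}\to\mathcal{A}$ is the solution of $$\pi^{\mathrm{TOQ}}=\operatorname*{argmin}_{\pi}\ \mathbb{E}^\pi\Big[\sum_{t=0}^N \mathbf{1}_{\mathcal{S}\setminus\mathcal{T}}(s_t)\Big]\quad\text{subject to}\quad \pi\in\operatorname*{argmax}_{\kappa}\ \mathbb{P}^\kappa[\boldsymbol{\omega}\models\psi].$$ Exact recursion for the support vectors. Each $\Gamma^*_{s,k}$ is a finite set of pairs $\langle\alpha,\beta\rangle$ of vectors in $\mathbb{R}^{|\mathcal{E}|}$. Initialization: $\Gamma^*_{s,N}=\{\langle 1_{|\mathcal{E}|},1_{|\mathcal{E}|}\rangle\}$ if $s\in\mathcal{T}$ and $\Gamma^*_{s,N}=\{\langle 0_{|\mathcal{E}|},0_{|\mathcal{E}|}\rangle\}$ otherwise (vectors of ones/zeros). For $k<N$, write $\Gamma^*_{s',k+1}=\{\langle\alpha^i_{s',k+1},\beta^i_{s',k+1}\rangle: i=1,\dots,|\Gamma^*_{s',k+1}|\}$ and set $$\alpha^{a,z,s',i}_{s,k}(e)=\frac{\mathbf{1}_{\mathcal{T}}(s)}{|\mathcal{Z}||\mathcal{S}|}+\sum_{e'}F(s,e,a,s',e',z)\,\alpha^i_{s',k+1}(e'),$$ $$\beta^{a,z,s',i}_{s,k}(e)=\frac{\mathbf{1}_{\mathcal{T}}(s)}{|\mathcal{Z}||\mathcal{S}|}+\mathbf{1}_{\mathcal{S}\setminus\mathcal{T}}(s)\sum_{e'}F(s,e,a,s',e',z)\,\beta^i_{s',k+1}(e'),$$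 $$\Gamma^{*,a}_{s,k}=\bigoplus_{z\in\mathcal{Z},\,s'\in\mathcal{S}}\big\{\langle\alpha^{a,z,s',i}_{s,k},\beta^{a,z,s',i}_{s,k}\rangle: i\in\{1,\dots,|\Gamma^*_{s',k+1}|\}\big\},\qquad \Gamma^*_{s,k}=\bigcup_{a\in\mathcal{A}}\Gamma^{*,a}_{s,k},$$ where $\Gamma\oplus\Lambda=\{\gamma+\lambda:\gamma\in\Gamma,\lambda\in\Lambda\}$, with pairs added componentwise.
   Formalization: Policies may depend on time, as the claim fails for stationary maps S×B→A (they need not attain the finite-horizon recursion's value); the policy is taken to be optimal for the remaining task from time k started at (s,b). *)

theory Defs
  imports "HOL-Probability.Probability" "HOL-Library.Set_Algebras"
begin

text \<open>The finite sets of observable states, partially observable states, actions and observations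
  are the finite types \<open>'s\<close>, \<open>'e\<close>, \<open>'a\<close>, \<open>'z\<close>.\<close>

record ('s, 'e, 'a, 'z) momdp =
  Ts :: "'s \<Rightarrow> 'e \<Rightarrow> 'a \<Rightarrow> 's pmf"
  Te :: "'s \<Rightarrow> 'e \<Rightarrow> 'a \<Rightarrow> 's \<Rightarrow> 'e pmf"
  Obs :: "'s \<Rightarrow> 'e \<Rightarrow> 'a \<Rightarrow> 'z pmf"

definition F :: "('s, 'e, 'a, 'z) momdp \<Rightarrow> 's \<Rightarrow> 'e \<Rightarrow> 'a \<Rightarrow> 's \<Rightarrow> 'e \<Rightarrow> 'z \<Rightarrow> real" where
  "F M s e a s' e' z = pmf (Ts M s e a) s' * pmf (Te M s e a s') e' * pmf (Obs M s' e' a) z"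

definition beliefs :: "(real ^ 'e) set" where
  "beliefs = {b. (\<forall>e. 0 \<le> b $ e) \<and> (\<Sum>e\<in>UNIV. b $ e) = 1}"

text \<open>The probability of receiving \<open>(s', z)\<close> after action \<open>a\<close> in \<open>(s, b)\<close>.\<close>

definition receive_prob ::
    "('s, 'e::finite, 'a, 'z) momdp \<Rightarrow> 's \<Rightarrow> real ^ 'e \<Rightarrow> 'a \<Rightarrow> 's \<Rightarrow> 'z \<Rightarrow> real" where
  "receive_prob M s b a s' z = (\<Sum>e'\<in>UNIV. \<Sum>e\<in>UNIV. F M s e a s' e' z * b $ e)"

text \<open>If \<open>(s', z)\<close> has probability zero, this is the zero vector; such receptions do not affect
  the closed-loop process.\<close>

definition belief_update ::
    "('s, 'e::finite, 'a, 'z) momdp \<Rightarrow> 's \<Rightarrow> real ^ 'e \<Rightarrow> 'a \<Rightarrow> 's \<Rightarrow> 'z \<Rightarrow> real ^ 'e" where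
  "belief_update M s b a s' z =
     (\<chi> e'. 1 / receive_prob M s b a s' z * (\<Sum>e\<in>UNIV. F M s e a s' e' z * b $ e))"

text \<open>At time \<open>t\<close> the policy \<open>\<kappa>\<close> selects \<open>a\<^sub>t = \<kappa> t s\<^sub>t b\<^sub>t\<close>. The time index is needed because the
  horizon is finite: stationary maps do not in general attain the value of the dynamic program.
  Values of \<open>\<kappa>\<close> outside of the belief simplex are irrelevant.\<close>

type_synonym ('s, 'e, 'a) policy = "nat \<Rightarrow> 's \<Rightarrow> real ^ 'e \<Rightarrow> 'a"

text \<open>The law of \<open>[\<omega>\<^sub>t, \<dots>, \<omega>\<^sub>N]\<close> given \<open>\<omega>\<^sub>t = (s, e)\<close> and \<open>b\<^sub>t = b\<close>.\<close>

function trajectory :: "('s, 'e::finite, 'a, 'z) momdp \<Rightarrow> nat \<Rightarrow> ('s, 'e, 'a) policy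
    \<Rightarrow> nat \<Rightarrow> 's \<Rightarrow> 'e \<Rightarrow> real ^ 'e \<Rightarrow> ('s \<times> 'e) list pmf" where
  "trajectory M N \<kappa> t s e b =
     (if t < N then
        bind_pmf (Ts M s e (\<kappa> t s b)) (\<lambda>s'.
        bind_pmf (Te M s e (\<kappa> t s b) s') (\<lambda>e'.
        bind_pmf (Obs M s' e' (\<kappa> t s b)) (\<lambda>z.
          map_pmf ((#) (s, e))
            (trajectory M N \<kappa> (Suc t) s' e' (belief_update M s b (\<kappa> t s b) s' z)))))
      else return_pmf [(s, e)])"
  by auto
termination by (relation "Wellfounded.measure (\<lambda>(M, N, \<kappa>, t, s, e, b). N - t)") auto

declare trajectory.simps [simp del]

text \<open>The law of \<open>[\<omega>\<^sub>k, \<dots>, \<omega>\<^sub>N]\<close> when \<open>s\<^sub>k = s\<close> and \<open>b\<^sub>k = b\<close>: the state \<open>e\<^sub>k\<close> has distribution \<open>b\<close>.\<close>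

definition closed_loop :: "('s, 'e::finite, 'a, 'z) momdp \<Rightarrow> nat \<Rightarrow> ('s, 'e, 'a) policy
    \<Rightarrow> nat \<Rightarrow> 's \<Rightarrow> real ^ 'e \<Rightarrow> ('s \<times> 'e) list pmf" where
  "closed_loop M N \<kappa> k s b =
     bind_pmf (embed_pmf (\<lambda>e. b $ e)) (\<lambda>e. trajectory M N \<kappa> k s e b)"

definition satisfies :: "'s set \<Rightarrow> ('s \<times> 'e) list \<Rightarrow> bool" where
  "satisfies T \<omega> \<longleftrightarrow> (\<exists>t<length \<omega>. fst (\<omega> ! t) \<in> T)"

definition sat_prob :: "('s, 'e::finite, 'a, 'z) momdp \<Rightarrow> 's set \<Rightarrow> nat \<Rightarrow> nat \<Rightarrow> 's \<Rightarrow> real ^ 'e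
    \<Rightarrow> ('s, 'e, 'a) policy \<Rightarrow> real" where
  "sat_prob M T N k s b \<kappa> = measure_pmf.prob (closed_loop M N \<kappa> k s b) {\<omega>. satisfies T \<omega>}"

definition expected_time :: "('s, 'e::finite, 'a, 'z) momdp \<Rightarrow> 's set \<Rightarrow> nat \<Rightarrow> nat \<Rightarrow> 's
    \<Rightarrow> real ^ 'e \<Rightarrow> ('s, 'e, 'a) policy \<Rightarrow> real" where
  "expected_time M T N k s b \<kappa> =
     measure_pmf.expectation (closed_loop M N \<kappa> k s b)
       (\<lambda>\<omega>. \<Sum>t<length \<omega>. indicator (- T) (fst (\<omega> ! t)))"

text \<open>The time-optimal quantitative problem for the task started at time \<open>k\<close> in \<open>(s, b)\<close>.
  A solution need not be unique.\<close>

definition is_toq :: "('s, 'e::finite, 'a, 'z) momdp \<Rightarrow> 's set \<Rightarrow> nat \<Rightarrow> nat \<Rightarrow> 's \<Rightarrow> real ^ 'e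
    \<Rightarrow> ('s, 'e, 'a) policy \<Rightarrow> bool" where
  "is_toq M T N k s b \<pi> \<longleftrightarrow>
     is_arg_min (expected_time M T N k s b)
       (is_arg_max (sat_prob M T N k s b) (\<lambda>\<kappa>. True)) \<pi>"

definition alpha_vec :: "('s::finite, 'e::finite, 'a, 'z::finite) momdp \<Rightarrow> 's set
    \<Rightarrow> 's \<Rightarrow> 'a \<Rightarrow> 'z \<Rightarrow> 's \<Rightarrow> real ^ 'e \<Rightarrow> real ^ 'e" where
  "alpha_vec M T s a z s' \<alpha> =
     (\<chi> e. indicator T s / (real CARD('z) * real CARD('s))
         + (\<Sum>e'\<in>UNIV. F M s e a s' e' z * \<alpha> $ e'))"

definition beta_vec :: "('s::finite, 'e::finite, 'a, 'z::finite) momdp \<Rightarrow> 's set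
    \<Rightarrow> 's \<Rightarrow> 'a \<Rightarrow> 'z \<Rightarrow> 's \<Rightarrow> real ^ 'e \<Rightarrow> real ^ 'e" where
  "beta_vec M T s a z s' \<beta> =
     (\<chi> e. indicator T s / (real CARD('z) * real CARD('s))
         + indicator (- T) s * (\<Sum>e'\<in>UNIV. F M s e a s' e' z * \<beta> $ e'))"

text \<open>The sums over \<open>z\<close> and \<open>s'\<close> are sums of sets, \<open>A + B = {x + y | x y. x \<in> A \<and> y \<in> B}\<close>, with
  componentwise addition of pairs.\<close>

function Gamma :: "('s::finite, 'e::finite, 'a::finite, 'z::finite) momdp \<Rightarrow> 's set
    \<Rightarrow> nat \<Rightarrow> 's \<Rightarrow> nat \<Rightarrow> ((real ^ 'e) \<times> (real ^ 'e)) set" where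
  "Gamma M T N s k =
     (if k < N then
        (\<Union>a. \<Sum>z\<in>UNIV. \<Sum>s'\<in>UNIV.
           (\<lambda>(\<alpha>, \<beta>). (alpha_vec M T s a z s' \<alpha>, beta_vec M T s a z s' \<beta>)) ` Gamma M T N s' (Suc k))
      else if s \<in> T then {(1, 1)} else {(0, 0)})"
  by auto
termination by (relation "Wellfounded.measure (\<lambda>(M, T, N, s, k). N - k)") auto

declare Gamma.simps [simp del]

definition J :: "('s::finite, 'e::finite, 'a::finite, 'z::finite) momdp \<Rightarrow> 's set
    \<Rightarrow> nat \<Rightarrow> nat \<Rightarrow> 's \<Rightarrow> real ^ 'e \<Rightarrow> real" where
  "J M T N k s b = (MAX (\<alpha>, \<beta>)\<in>Gamma M T N s k. \<beta> \<bullet> b)"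

text \<open>The problem always has a solution: only finitely many laws of the closed-loop process arise
  as the policy varies.\<close>

lemma finite_range_trajectory:
  fixes M :: "('s::finite, 'e::finite, 'a::finite, 'z::finite) momdp"
  shows "finite (range (\<lambda>\<kappa> e. trajectory M N \<kappa> t s e b))"
proof (induction "N - t" arbitrary: t s b)
  case 0
  then have "range (\<lambda>\<kappa> e. trajectory M N \<kappa> t s e b) \<subseteq> {\<lambda>e. return_pmf [(s, e)]}"
    by (subst trajectory.simps) auto
  then show ?case
    by (rule finite_subset) simp
next
  case (Suc n)
  then have t: "t < N" and n: "n = N - Suc t"
    by auto
  define R where "R = (\<lambda>(a, s', z).
    range (\<lambda>\<kappa> e. trajectory M N \<kappa> (Suc t) s' e (belief_update M s b a s' z)))"
  define Phi where "Phi = (\<lambda>(a, g) e.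
    bind_pmf (Ts M s e a) (\<lambda>s'. bind_pmf (Te M s e a s') (\<lambda>e'. bind_pmf (Obs M s' e' a) (\<lambda>z.
      map_pmf ((#) (s, e)) (g (a, s', z) e')))))"
  have fin: "finite (R x)" for x
    using Suc(1)[OF n] by (auto simp: R_def split: prod.split)
  have "finite (Pi\<^sub>E UNIV R)"
    by (rule finite_PiE) (auto simp: fin)
  then have "finite (Phi ` (UNIV \<times> Pi\<^sub>E UNIV R))"
    by auto
  moreover have "(\<lambda>e. trajectory M N \<kappa> t s e b) \<in> Phi ` (UNIV \<times> Pi\<^sub>E UNIV R)" for \<kappa>
  proof (rule image_eqI)
    let ?g = "\<lambda>(a, s', z) e. trajectory M N \<kappa> (Suc t) s' e (belief_update M s b a s' z)"
    show "(\<lambda>e. trajectory M N \<kappa> t s e b) = Phi (\<kappa> t s b, ?g)"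
      by (rule ext, subst trajectory.simps) (simp add: t Phi_def)
    show "(\<kappa> t s b, ?g) \<in> UNIV \<times> Pi\<^sub>E UNIV R"
      by (auto simp: R_def)
  qed
  ultimately show ?case
    by (auto intro: finite_subset)
qed

lemma is_toq_exists:
  fixes M :: "('s::finite, 'e::finite, 'a::finite, 'z::finite) momdp"
  shows "\<exists>\<pi>. is_toq M T N k s b \<pi>"
proof -
  define L where "L = (\<lambda>\<kappa>. closed_loop M N \<kappa> k s b)"
  have "range L = (\<lambda>g. bind_pmf (embed_pmf (\<lambda>e. b $ e)) g) `
      range (\<lambda>\<kappa> e. trajectory M N \<kappa> k s e b)"
    by (auto simp: L_def closed_loop_def image_image)
  then have fin: "finite (range L)"
    by (simp add: finite_range_trajectory)
  let ?p = "sat_prob M T N k s b" and ?c = "expected_time M T N k s b"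
  have p: "finite (range ?p)"
    using finite_imageI[OF fin, of "\<lambda>l. measure_pmf.prob l {\<omega>. satisfies T \<omega>}"]
    by (simp add: sat_prob_def L_def image_image)
  have c: "finite (range ?c)"
    using finite_imageI[OF fin, of "\<lambda>l. measure_pmf.expectation l
        (\<lambda>\<omega>. \<Sum>t<length \<omega>. indicator (- T) (fst (\<omega> ! t)))"]
    by (simp add: expected_time_def L_def image_image)
  have "Max (range ?p) \<in> range ?p"
    using p by (intro Max_in) auto
  then obtain \<kappa> where "?p \<kappa> = Max (range ?p)"
    by auto
  then have max: "is_arg_max ?p (\<lambda>\<kappa>. True) \<kappa>"
    using p by (auto simp: is_arg_max_linorder)
  let ?A = "Collect (is_arg_max ?p (\<lambda>\<kappa>. True))"
  have cA: "finite (?c ` ?A)"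
    using c by (rule finite_subset[rotated]) auto
  then have "Min (?c ` ?A) \<in> ?c ` ?A"
    using max by (intro Min_in) auto
  then obtain \<pi> where "\<pi> \<in> ?A" "?c \<pi> = Min (?c ` ?A)"
    by auto
  then have "is_toq M T N k s b \<pi>"
    using cA by (auto simp: is_toq_def is_arg_min_linorder)
  then show ?thesis
    by blast
qed

end

theory Submission imports Defs begin

text \<open>For a fixed policy, the probabilities of reaching the target from the various hidden states
  form a vector that obeys the recursion for \<open>\<beta>\<close>, so it is one of the support vectors: no
  policy beats \<open>J\<close>. Conversely, the policy that is greedy for \<open>J\<close> attains every support vector,
  because \<open>\<beta> \<bullet> b\<close> is linear in \<open>b\<close> and the normalization constant of the belief update
  therefore cancels. Hence \<open>J\<close> is the largest satisfaction probability, which every time-optimal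
  quantitative policy attains.\<close>

definition sat_vec :: "('s, 'e::finite, 'a, 'z) momdp \<Rightarrow> 's set \<Rightarrow> nat \<Rightarrow> ('s, 'e, 'a) policy
    \<Rightarrow> nat \<Rightarrow> 's \<Rightarrow> real ^ 'e \<Rightarrow> real ^ 'e" where
  "sat_vec M T N \<kappa> t s b =
     (\<chi> e. measure_pmf.prob (trajectory M N \<kappa> t s e b) {\<omega>. satisfies T \<omega>})"

definition unnormalized_update ::
    "('s, 'e::finite, 'a, 'z) momdp \<Rightarrow> 's \<Rightarrow> real ^ 'e \<Rightarrow> 'a \<Rightarrow> 's \<Rightarrow> 'z \<Rightarrow> real ^ 'e" where
  "unnormalized_update M s b a s' z = (\<chi> e'. \<Sum>e\<in>UNIV. F M s e a s' e' z * b $ e)"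

definition greedy_policy ::
    "('s::finite, 'e::finite, 'a::finite, 'z::finite) momdp \<Rightarrow> 's set \<Rightarrow> nat
      \<Rightarrow> ('s, 'e, 'a) policy" where
  "greedy_policy M T N t s b =
     arg_max (\<lambda>a. \<Sum>z\<in>UNIV. \<Sum>s'\<in>UNIV.
       J M T N (Suc t) s' (unnormalized_update M s b a s' z)) (\<lambda>_. True)"

lemma F_nonneg: "0 \<le> F M s e a s' e' z"
  by (simp add: F_def)

lemma satisfies_Cons [simp]: "satisfies T ((s, e) # \<omega>) \<longleftrightarrow> s \<in> T \<or> satisfies T \<omega>"
proof -
  have "satisfies T \<omega> \<longleftrightarrow> (\<exists>x\<in>set \<omega>. fst x \<in> T)" for \<omega> :: "('a \<times> 'b) list"
    unfolding satisfies_def by (metis in_set_conv_nth)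
  then show ?thesis
    by simp
qed

lemma satisfies_Nil [simp]: "\<not> satisfies T []"
  by (simp add: satisfies_def)

lemma prob_bind_pmf_finite:
  fixes p :: "'x::finite pmf"
  shows "measure_pmf.prob (bind_pmf p f) A = (\<Sum>x\<in>UNIV. pmf p x * measure_pmf.prob (f x) A)"
proof -
  have "ennreal (measure_pmf.prob (bind_pmf p f) A) =
      (\<Sum>x\<in>UNIV. ennreal (measure_pmf.prob (f x) A) * ennreal (pmf p x))"
    by (simp add: measure_pmf.emeasure_eq_measure[symmetric])
      (simp add: nn_integral_measure_pmf nn_integral_count_space_finite mult.commute)
  also have "\<dots> = ennreal (\<Sum>x\<in>UNIV. pmf p x * measure_pmf.prob (f x) A)"
    by (simp add: ennreal_mult'[symmetric] sum_ennreal mult.commute)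
  finally show ?thesis
    by (simp add: sum_nonneg)
qed

lemma sat_vec_target:
  assumes "s \<in> T"
  shows "sat_vec M T N \<kappa> t s b = 1"
proof -
  have "measure_pmf.prob (trajectory M N \<kappa> t s e b) {\<omega>. satisfies T \<omega>} = 1" for e
    by (subst measure_pmf.prob_eq_1, simp, subst trajectory.simps)
      (auto simp: assms AE_measure_pmf_iff)
  then show ?thesis
    by (simp add: sat_vec_def vec_eq_iff)
qed

lemma sat_vec_final:
  assumes "s \<notin> T" "\<not> t < N"
  shows "sat_vec M T N \<kappa> t s b = 0"
  unfolding sat_vec_def vec_eq_iff
  by (subst trajectory.simps) (simp add: assms)

lemma sat_vec_step:
  fixes M :: "('s::finite, 'e::finite, 'a::finite, 'z::finite) momdp"
    and \<kappa> :: "('s, 'e, 'a) policy" and s :: 's and b :: "real ^ 'e"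
  assumes "t < N" "s \<notin> T"
  defines "a \<equiv> \<kappa> t s b"
  shows "sat_vec M T N \<kappa> t s b $ e = (\<Sum>z\<in>UNIV. \<Sum>s'\<in>UNIV. \<Sum>e'\<in>UNIV.
    F M s e a s' e' z * sat_vec M T N \<kappa> (Suc t) s' (belief_update M s b a s' z) $ e')"
proof -
  have "sat_vec M T N \<kappa> t s b $ e = (\<Sum>s'\<in>UNIV. \<Sum>e'\<in>UNIV. \<Sum>z\<in>UNIV.
    F M s e a s' e' z * sat_vec M T N \<kappa> (Suc t) s' (belief_update M s b a s' z) $ e')"
    using assms
    by (subst sat_vec_def, subst trajectory.simps)
      (simp add: prob_bind_pmf_finite sat_vec_def F_def sum_distrib_left mult.assoc vimage_def)
  also have "\<dots> = (\<Sum>s'\<in>UNIV. \<Sum>z\<in>UNIV. \<Sum>e'\<in>UNIV.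
    F M s e a s' e' z * sat_vec M T N \<kappa> (Suc t) s' (belief_update M s b a s' z) $ e')"
    by (intro sum.cong refl sum.swap)
  finally show ?thesis
    by (subst sum.swap)
qed

lemma sum_beta_vec:
  fixes M :: "('s::finite, 'e::finite, 'a, 'z::finite) momdp"
  shows "(\<Sum>z\<in>UNIV. \<Sum>s'\<in>UNIV. beta_vec M T s a z s' (f z s')) =
    (if s \<in> T then 1
     else \<chi> e. \<Sum>z\<in>UNIV. \<Sum>s'\<in>UNIV. \<Sum>e'\<in>UNIV. F M s e a s' e' z * f z s' $ e')"
  by (simp add: beta_vec_def vec_eq_iff)

lemma sat_vec_eq_sum_beta_vec:
  fixes M :: "('s::finite, 'e::finite, 'a::finite, 'z::finite) momdp"
    and \<kappa> :: "('s, 'e, 'a) policy" and s :: 's and b :: "real ^ 'e"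
  assumes "t < N"
  defines "a \<equiv> \<kappa> t s b"
  shows "sat_vec M T N \<kappa> t s b = (\<Sum>z\<in>UNIV. \<Sum>s'\<in>UNIV.
    beta_vec M T s a z s' (sat_vec M T N \<kappa> (Suc t) s' (belief_update M s b a s' z)))"
  using assms by (simp add: sum_beta_vec sat_vec_target vec_eq_iff sat_vec_step)

lemma sum_beta_vec_inner:
  fixes M :: "('s::finite, 'e::finite, 'a, 'z::finite) momdp"
  assumes "s \<notin> T"
  shows "(\<Sum>z\<in>UNIV. \<Sum>s'\<in>UNIV. beta_vec M T s a z s' (f z s')) \<bullet> b =
    (\<Sum>z\<in>UNIV. \<Sum>s'\<in>UNIV. f z s' \<bullet> unnormalized_update M s b a s' z)"
proof -
  have "beta_vec M T s a z s' (f z s') \<bullet> b = f z s' \<bullet> unnormalized_update M s b a s' z" for z s'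
  proof -
    have "beta_vec M T s a z s' (f z s') \<bullet> b =
        (\<Sum>e\<in>UNIV. \<Sum>e'\<in>UNIV. F M s e a s' e' z * f z s' $ e' * b $ e)"
      using assms by (simp add: beta_vec_def inner_vec_def sum_distrib_right)
    also have "\<dots> = f z s' \<bullet> unnormalized_update M s b a s' z"
      by (subst sum.swap)
        (simp add: unnormalized_update_def inner_vec_def sum_distrib_left mult_ac)
    finally show ?thesis .
  qed
  then show ?thesis
    by (simp add: inner_sum_left)
qed

lemma unnormalized_update_eq:
  assumes "\<And>e. 0 \<le> b $ e"
  shows "unnormalized_update M s b a s' z =
    receive_prob M s b a s' z *\<^sub>R belief_update M s b a s' z"
proof (cases "receive_prob M s b a s' z = 0")
  case True
  then have "(\<Sum>e\<in>UNIV. F M s e a s' e' z * b $ e) = 0" for e'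
    unfolding receive_prob_def
    by (subst (asm) sum_nonneg_eq_0_iff) (auto intro!: sum_nonneg mult_nonneg_nonneg F_nonneg assms)
  with True show ?thesis
    by (simp add: unnormalized_update_def vec_eq_iff)
next
  case False
  then show ?thesis
    by (simp add: unnormalized_update_def belief_update_def vec_eq_iff)
qed

lemma receive_prob_nonneg:
  assumes "\<And>e. 0 \<le> b $ e"
  shows "0 \<le> receive_prob M s b a s' z"
  unfolding receive_prob_def by (intro sum_nonneg mult_nonneg_nonneg F_nonneg assms)

lemma belief_update_nonneg:
  assumes "\<And>e. 0 \<le> b $ e"
  shows "0 \<le> belief_update M s b a s' z $ e'"
  using receive_prob_nonneg[OF assms]
  by (auto simp: belief_update_def assms F_nonneg
      intro!: divide_nonneg_nonneg mult_nonneg_nonneg sum_nonneg)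

lemma finite_Gamma:
  fixes M :: "('s::finite, 'e::finite, 'a::finite, 'z::finite) momdp"
  shows "finite (Gamma M T N s k)"
proof (induction "N - k" arbitrary: s k)
  case 0
  then show ?case
    by (subst Gamma.simps) auto
next
  case (Suc n)
  have fin: "finite (\<Sum>i\<in>I. A i)" if "finite I" "\<And>i. finite (A i)"
    for I :: "'i set" and A :: "'i \<Rightarrow> ((real ^ 'e) \<times> (real ^ 'e)) set"
    using that by (induction I) (auto intro: finite_set_plus)
  have "finite (Gamma M T N s' (Suc k))" for s'
    using Suc by auto
  then show ?case
    by (subst Gamma.simps) (auto intro!: fin)
qed

lemma sum_sum_image_alt:
  fixes h :: "'i::finite \<Rightarrow> 'j::finite \<Rightarrow> 'x \<Rightarrow> 'y::comm_monoid_add"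
  shows "(\<Sum>i\<in>UNIV. \<Sum>j\<in>UNIV. h i j ` C j) =
    {\<Sum>i\<in>UNIV. \<Sum>j\<in>UNIV. h i j (f i j) |f. \<forall>i j. f i j \<in> C j}"
proof -
  have "(\<Sum>i\<in>UNIV. \<Sum>j\<in>UNIV. h i j ` C j) = (\<Sum>(i, j)\<in>UNIV. h i j ` C j)"
    by (simp add: sum.cartesian_product)
  also have "\<dots> = {sum g UNIV |g. \<forall>(i, j)\<in>UNIV. g (i, j) \<in> h i j ` C j}"
    by (subst set_sum_alt) (auto simp: split_beta)
  also have "\<dots> = {\<Sum>i\<in>UNIV. \<Sum>j\<in>UNIV. h i j (f i j) |f. \<forall>i j. f i j \<in> C j}"
  proof safe
    fix g :: "'i \<times> 'j \<Rightarrow> 'y" assume "\<forall>(i, j)\<in>UNIV. g (i, j) \<in> h i j ` C j"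
    then have "\<forall>i j. \<exists>x. x \<in> C j \<and> g (i, j) = h i j x"
      by auto
    then obtain f where "\<forall>i j. f i j \<in> C j \<and> g (i, j) = h i j (f i j)"
      by metis
    moreover have "sum g UNIV = (\<Sum>i\<in>UNIV. \<Sum>j\<in>UNIV. g (i, j))"
      by (simp add: sum.cartesian_product)
    ultimately show "\<exists>f. sum g UNIV = (\<Sum>i\<in>UNIV. \<Sum>j\<in>UNIV. h i j (f i j)) \<and>
        (\<forall>i j. f i j \<in> C j)"
      by auto
  next
    fix f :: "'i \<Rightarrow> 'j \<Rightarrow> 'x" assume "\<forall>i j. f i j \<in> C j"
    then show "\<exists>g. (\<Sum>i\<in>UNIV. \<Sum>j\<in>UNIV. h i j (f i j)) = sum g UNIV \<and>
        (\<forall>(i, j)\<in>UNIV. g (i, j) \<in> h i j ` C j)"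
      by (intro exI[of _ "\<lambda>(i, j). h i j (f i j)"]) (auto simp: sum.cartesian_product)
  qed
  finally show ?thesis .
qed

lemma snd_Gamma_step:
  fixes M :: "('s::finite, 'e::finite, 'a::finite, 'z::finite) momdp"
  assumes "k < N"
  shows "snd ` Gamma M T N s k = (\<Union>a. {\<Sum>z\<in>UNIV. \<Sum>s'\<in>UNIV. beta_vec M T s a z s' (f z s') |f.
    \<forall>z s'. f z s' \<in> snd ` Gamma M T N s' (Suc k)})"
proof -
  have snd_sum: "snd ` (\<Sum>i\<in>UNIV. A i) = (\<Sum>i\<in>UNIV. snd ` A i)"
    for A :: "'i::finite \<Rightarrow> ((real ^ 'e) \<times> (real ^ 'e)) set"
  proof -
    have "snd ` (X + Y) = snd ` X + snd ` Y" for X Y :: "((real ^ 'e) \<times> (real ^ 'e)) set"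
      by (simp add: set_plus_image image_image split_beta) (force simp: image_iff)
    then show ?thesis
      using sum_comp_morphism[of "image snd" A UNIV] by (simp add: o_def set_zero)
  qed
  have "snd ` Gamma M T N s k = (\<Union>a. \<Sum>z\<in>UNIV. \<Sum>s'\<in>UNIV.
      beta_vec M T s a z s' ` snd ` Gamma M T N s' (Suc k))"
    using assms
    by (subst Gamma.simps) (simp add: image_UN snd_sum image_image case_prod_unfold)
  then show ?thesis
    by (simp only: sum_sum_image_alt)
qed

lemma sat_vec_in_Gamma:
  fixes M :: "('s::finite, 'e::finite, 'a::finite, 'z::finite) momdp"
  shows "sat_vec M T N \<kappa> k s b \<in> snd ` Gamma M T N s k"
proof (induction "N - k" arbitrary: s k b)
  case 0
  then show ?case
    by (subst Gamma.simps) (simp add: sat_vec_target sat_vec_final)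
next
  case (Suc n)
  then have k: "k < N" and n: "n = N - Suc k"
    by auto
  show ?case
    unfolding snd_Gamma_step[OF k]
    by (rule UN_I[OF UNIV_I], rule CollectI, rule exI, rule conjI,
        rule sat_vec_eq_sum_beta_vec[OF k]) (intro allI Suc(1)[OF n])
qed

lemma Gamma_nonempty:
  fixes M :: "('s::finite, 'e::finite, 'a::finite, 'z::finite) momdp"
  shows "Gamma M T N s k \<noteq> {}"
  using sat_vec_in_Gamma by blast

lemma J_eq_Max: "J M T N k s b = Max ((\<lambda>\<beta>. \<beta> \<bullet> b) ` snd ` Gamma M T N s k)"
  by (simp add: J_def image_image case_prod_unfold)

lemma J_ge: "\<beta> \<in> snd ` Gamma M T N s k \<Longrightarrow> \<beta> \<bullet> b \<le> J M T N k s b"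
  unfolding J_eq_Max by (rule Max_ge) (simp_all add: finite_Gamma)

lemma J_le:
  assumes "\<And>\<beta>. \<beta> \<in> snd ` Gamma M T N s k \<Longrightarrow> \<beta> \<bullet> b \<le> c"
  shows "J M T N k s b \<le> c"
  unfolding J_eq_Max using assms
  by (subst Max_le_iff) (simp_all add: finite_Gamma Gamma_nonempty)

lemma arg_max_ge_finite:
  fixes f :: "'a::finite \<Rightarrow> 'b::linorder"
  shows "f x \<le> f (arg_max f (\<lambda>_. True))"
proof -
  have "Max (range f) \<in> range f"
    by (intro Max_in) auto
  then obtain y where "Max (range f) = f y"
    by (rule rangeE)
  moreover have "f z \<le> Max (range f)" for z
    by simp
  ultimately show ?thesis
    by (intro arg_maxI[where P = "\<lambda>_. True" and x = y and Q = "\<lambda>y. f x \<le> f y"])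
      (simp_all add: not_less)
qed

lemma J_le_greedy_policy:
  fixes M :: "('s::finite, 'e::finite, 'a::finite, 'z::finite) momdp"
  assumes "\<And>e. 0 \<le> b $ e"
  shows "J M T N k s b \<le> sat_vec M T N (greedy_policy M T N) k s b \<bullet> b"
  using assms
proof (induction "N - k" arbitrary: s k b)
  case 0
  then have "snd ` Gamma M T N s k = {sat_vec M T N (greedy_policy M T N) k s b}"
    by (subst Gamma.simps) (simp add: sat_vec_target sat_vec_final)
  then show ?case
    by (intro J_le) simp
next
  case (Suc n)
  then have k: "k < N" and n: "n = N - Suc k"
    by auto
  let ?\<kappa> = "greedy_policy M T N"
  let ?W = "unnormalized_update M s b" and ?B = "belief_update M s b"
  let ?G = "\<lambda>a. \<Sum>z\<in>UNIV. \<Sum>s'\<in>UNIV. J M T N (Suc k) s' (?W a s' z)"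
  show ?case
  proof (rule J_le)
    fix \<beta> assume "\<beta> \<in> snd ` Gamma M T N s k"
    then obtain a f where \<beta>: "\<beta> = (\<Sum>z\<in>UNIV. \<Sum>s'\<in>UNIV. beta_vec M T s a z s' (f z s'))"
      and f: "\<And>z s'. f z s' \<in> snd ` Gamma M T N s' (Suc k)"
      unfolding snd_Gamma_step[OF k] by blast
    show "\<beta> \<bullet> b \<le> sat_vec M T N ?\<kappa> k s b \<bullet> b"
    proof (cases "s \<in> T")
      case True
      then show ?thesis
        by (simp add: \<beta> sum_beta_vec sat_vec_target)
    next
      case False
      define a' where "a' = ?\<kappa> k s b"
      have step: "J M T N (Suc k) s' (?W a' s' z) \<le>
          sat_vec M T N ?\<kappa> (Suc k) s' (?B a' s' z) \<bullet> ?W a' s' z" for s' z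
      proof (rule J_le)
        fix \<gamma> assume "\<gamma> \<in> snd ` Gamma M T N s' (Suc k)"
        then have "\<gamma> \<bullet> ?B a' s' z \<le> sat_vec M T N ?\<kappa> (Suc k) s' (?B a' s' z) \<bullet> ?B a' s' z"
          using Suc(1)[OF n belief_update_nonneg[OF Suc(3)]] by (rule order_trans[OF J_ge])
        then show "\<gamma> \<bullet> ?W a' s' z \<le> sat_vec M T N ?\<kappa> (Suc k) s' (?B a' s' z) \<bullet> ?W a' s' z"
          using Suc(3) by (simp add: unnormalized_update_eq receive_prob_nonneg mult_left_mono)
      qed
      have "\<beta> \<bullet> b = (\<Sum>z\<in>UNIV. \<Sum>s'\<in>UNIV. f z s' \<bullet> ?W a s' z)"
        unfolding \<beta> by (rule sum_beta_vec_inner[OF False])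
      also have "\<dots> \<le> ?G a"
        by (intro sum_mono J_ge f)
      also have "\<dots> \<le> ?G a'"
        unfolding a'_def greedy_policy_def by (rule arg_max_ge_finite)
      also have "\<dots> \<le> (\<Sum>z\<in>UNIV. \<Sum>s'\<in>UNIV.
          sat_vec M T N ?\<kappa> (Suc k) s' (?B a' s' z) \<bullet> ?W a' s' z)"
        by (intro sum_mono step)
      also have "\<dots> = sat_vec M T N ?\<kappa> k s b \<bullet> b"
        by (simp add: sat_vec_eq_sum_beta_vec[OF k] sum_beta_vec_inner[OF False] a'_def)
      finally show ?thesis .
    qed
  qed
qed

lemma sat_prob_eq_inner:
  assumes "b \<in> beliefs"
  shows "sat_prob M T N k s b \<kappa> = sat_vec M T N \<kappa> k s b \<bullet> b"
proof -
  have b: "\<And>e. 0 \<le> b $ e" "(\<Sum>e\<in>UNIV. b $ e) = 1"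
    using assms by (auto simp: beliefs_def)
  have "pmf (embed_pmf (($) b)) e = b $ e" for e
    using b by (intro pmf_embed_pmf) (auto simp: nn_integral_count_space_finite sum_ennreal)
  then show ?thesis
    by (simp add: sat_prob_def closed_loop_def prob_bind_pmf_finite sat_vec_def inner_vec_def
        mult.commute)
qed

theorem lemma3:
  fixes M :: "('s::finite, 'e::finite, 'a::finite, 'z::finite) momdp"
    and T :: "'s set" and N :: nat
  shows "\<forall>k\<in>{0..N}. \<forall>s. \<forall>b\<in>beliefs. \<forall>\<pi>. is_toq M T N k s b \<pi> \<longrightarrow>
           J M T N k s b = sat_prob M T N k s b \<pi>"
proof (intro ballI allI impI antisym)
  fix k s \<pi> and b :: "real ^ 'e"
  assume b: "b \<in> beliefs" and "is_toq M T N k s b \<pi>"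
  then have "sat_prob M T N k s b (greedy_policy M T N) \<le> sat_prob M T N k s b \<pi>"
    by (auto simp: is_toq_def is_arg_min_def is_arg_max_linorder)
  moreover have "J M T N k s b \<le> sat_prob M T N k s b (greedy_policy M T N)"
    unfolding sat_prob_eq_inner[OF b] using b by (intro J_le_greedy_policy) (simp add: beliefs_def)
  ultimately show "J M T N k s b \<le> sat_prob M T N k s b \<pi>"
    by simp
  show "sat_prob M T N k s b \<pi> \<le> J M T N k s b"
    unfolding sat_prob_eq_inner[OF b] by (rule J_ge[OF sat_vec_in_Gamma])
qed

end
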